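(* Let $c,d\in\mathbb{Z}\setminus\{0\}$ be such that $\gcd(c,d)=1$. The following are equivalent: (1) there exists a non-empty reduced string $\sigma\in\mathbb{Z}^{<\omega}$ such that, for all additively idempotent ultrafilters $\mathcal{U}\in\beta\mathbb{Z}$, $\sigma\mathcal{U}\models c(x-y)+dz=0$; (2) $|c|=|d|=1$.
   Context: $\beta\mathbb{Z}$ is the set of all ultrafilters on $\mathbb{Z}$, with addition $A\in\mathcal{U}+\mathcal{V}\iff\{n\in\mathbb{Z}:\{k\in\mathbb{Z}:n+k\in A\}\in\mathcal{V}\}\in\mathcal{U}$; $\mathcal{U}$ is additively idempotent if $\mathcal{U}+\mathcal{U}=\mathcal{U}$. For $a\in\mathbb{Z}$, $a\,\mathcal{U}$ is the ultrafilter with $A\in a\,\mathcal{U}\iff\{n: an\in A\}\in\mathcal{U}$. For $\mathcal{V}\in\beta\mathbb{Z}$ and a polynomial $P\in\mathbb{Z}[x_1,\dots,x_m]$, $\mathcal{V}\models P(x_1,\dots,x_m)=0$ means: for every $A\in\mathcal{V}$ there exist $b_1,\dots,b_m\in A$ with $P(b_1,\dots,b_m)=0$. $\mathbb{Z}^{<\omega}=\bigcup_{k\ge 0}\mathbb{Z}^k$ is the set of finite strings of integers. For $\sigma=(a_1,\dots,a_n)$, $\sigma\,\mathcal{U}=a_1\mathcal{U}+\dots+a_n\mathcal{U}$. A string $(a_1,\dots,a_n)$ is reduced if all $a_i\ne0$ and $a_i\ne a_{i+1}$ for $1\le i\le n-1$. *)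

theory Defs
  imports Complex_Main
begin

(* A set A belongs to the ultrafilter U iff "eventually (\<lambda>n. n \<in> A) U".
   The type of filters includes the improper filter bot, which has to be excluded. *)

definition ultrafilter :: "'a filter \<Rightarrow> bool" where
  "ultrafilter U \<longleftrightarrow> U \<noteq> bot \<and> (\<forall>P. eventually P U \<or> eventually (\<lambda>x. \<not> P x) U)"

definition beta_Z :: "int filter set" where
  "beta_Z = {U. ultrafilter U}"

definition uf_add :: "int filter \<Rightarrow> int filter \<Rightarrow> int filter" (infixl "\<oplus>\<^sub>\<beta>" 65) where
  "U \<oplus>\<^sub>\<beta> V = Abs_filter (\<lambda>P. eventually (\<lambda>n. eventually (\<lambda>k. P (n + k)) V) U)"

definition idempotent_uf :: "int filter \<Rightarrow> bool" where
  "idempotent_uf U \<longleftrightarrow> U \<oplus>\<^sub>\<beta> U = U"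

definition uf_scale :: "int \<Rightarrow> int filter \<Rightarrow> int filter" (infixr "\<cdot>\<^sub>\<beta>" 75) where
  "a \<cdot>\<^sub>\<beta> U = filtermap (\<lambda>n. a * n) U"

(* principal 0 is the neutral element of the addition, so it is the value of the empty sum. *)

definition string_uf :: "int list \<Rightarrow> int filter \<Rightarrow> int filter" where
  "string_uf \<sigma> U = foldr (\<lambda>a V. a \<cdot>\<^sub>\<beta> U \<oplus>\<^sub>\<beta> V) \<sigma> (principal {0})"

definition reduced_string :: "int list \<Rightarrow> bool" where
  "reduced_string \<sigma> \<longleftrightarrow> (\<forall>a\<in>set \<sigma>. a \<noteq> 0) \<and> distinct_adj \<sigma>"

(* V satisfies the equation P(x_1,...,x_m) = 0. The polynomial P enters only through its
   evaluation at the list [b_1,...,b_m]; the b_i need not be distinct. *)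

definition uf_satisfies :: "int filter \<Rightarrow> nat \<Rightarrow> (int list \<Rightarrow> int) \<Rightarrow> bool" where
  "uf_satisfies V m P \<longleftrightarrow>
     (\<forall>A. eventually (\<lambda>n. n \<in> A) V \<longrightarrow>
        (\<exists>bs. length bs = m \<and> set bs \<subseteq> A \<and> P bs = 0))"

lemma eventually_uf_add:
  "eventually P (U \<oplus>\<^sub>\<beta> V) \<longleftrightarrow> eventually (\<lambda>n. eventually (\<lambda>k. P (n + k)) V) U"
  unfolding uf_add_def
proof (rule eventually_Abs_filter, rule is_filter.intro)
  show "\<forall>\<^sub>F n in U. \<forall>\<^sub>F k in V. True" by simp
next
  fix P Q :: "int \<Rightarrow> bool"
  assume "\<forall>\<^sub>F n in U. \<forall>\<^sub>F k in V. P (n + k)" "\<forall>\<^sub>F n in U. \<forall>\<^sub>F k in V. Q (n + k)"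
  then show "\<forall>\<^sub>F n in U. \<forall>\<^sub>F k in V. P (n + k) \<and> Q (n + k)"
    by eventually_elim (rule eventually_conj)
next
  fix P Q :: "int \<Rightarrow> bool"
  assume PQ: "\<forall>x. P x \<longrightarrow> Q x" and P: "\<forall>\<^sub>F n in U. \<forall>\<^sub>F k in V. P (n + k)"
  from P show "\<forall>\<^sub>F n in U. \<forall>\<^sub>F k in V. Q (n + k)"
    by eventually_elim (use PQ in \<open>auto elim: eventually_mono\<close>)
qed

lemma mem_uf_add:
  "(\<forall>\<^sub>F n in U \<oplus>\<^sub>\<beta> V. n \<in> A) \<longleftrightarrow> (\<forall>\<^sub>F n in U. n \<in> {n. \<forall>\<^sub>F k in V. k \<in> {k. n + k \<in> A}})"
  by (simp add: eventually_uf_add)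

lemma mem_uf_scale:
  "(\<forall>\<^sub>F n in a \<cdot>\<^sub>\<beta> U. n \<in> A) \<longleftrightarrow> (\<forall>\<^sub>F n in U. n \<in> {n. a * n \<in> A})"
  by (simp add: uf_scale_def eventually_filtermap)

lemma uf_add_in_beta_Z:
  assumes "U \<in> beta_Z" "V \<in> beta_Z"
  shows "U \<oplus>\<^sub>\<beta> V \<in> beta_Z"
proof -
  have UV: "ultrafilter U" "ultrafilter V" using assms by (auto simp: beta_Z_def)
  have "eventually P (U \<oplus>\<^sub>\<beta> V) \<or> eventually (\<lambda>x. \<not> P x) (U \<oplus>\<^sub>\<beta> V)" for P
  proof (cases "\<forall>\<^sub>F n in U. \<forall>\<^sub>F k in V. P (n + k)")
    case False
    then have "\<forall>\<^sub>F n in U. \<not> (\<forall>\<^sub>F k in V. P (n + k))"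
      using UV(1) by (auto simp: ultrafilter_def)
    then have "\<forall>\<^sub>F n in U. \<forall>\<^sub>F k in V. \<not> P (n + k)"
      by eventually_elim (use UV(2) in \<open>auto simp: ultrafilter_def\<close>)
    then show ?thesis by (simp add: eventually_uf_add)
  qed (simp add: eventually_uf_add)
  moreover have "U \<oplus>\<^sub>\<beta> V \<noteq> bot"
    using UV by (simp add: ultrafilter_def trivial_limit_def eventually_uf_add)
  ultimately show ?thesis by (simp add: beta_Z_def ultrafilter_def)
qed

lemma uf_scale_in_beta_Z: "U \<in> beta_Z \<Longrightarrow> a \<cdot>\<^sub>\<beta> U \<in> beta_Z"
  by (auto simp: beta_Z_def ultrafilter_def uf_scale_def eventually_filtermap filtermap_bot_iff)

lemma uf_add_principal_0 [simp]: "U \<oplus>\<^sub>\<beta> principal {0} = U" "principal {0} \<oplus>\<^sub>\<beta> U = U"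
  by (auto simp: filter_eq_iff eventually_uf_add eventually_principal)

lemma uf_add_assoc: "(U \<oplus>\<^sub>\<beta> V) \<oplus>\<^sub>\<beta> W = U \<oplus>\<^sub>\<beta> (V \<oplus>\<^sub>\<beta> W)"
  by (simp add: filter_eq_iff eventually_uf_add add.assoc)

lemma string_uf_simps [simp]:
  "string_uf [] U = principal {0}"
  "string_uf [a] U = a \<cdot>\<^sub>\<beta> U"
  "string_uf (a # \<sigma>) U = a \<cdot>\<^sub>\<beta> U \<oplus>\<^sub>\<beta> string_uf \<sigma> U"
  by (simp_all add: string_uf_def)

lemma string_uf_in_beta_Z: "U \<in> beta_Z \<Longrightarrow> string_uf \<sigma> U \<in> beta_Z"
proof (induction \<sigma>)
  case Nil
  then show ?case
    by (auto simp: beta_Z_def ultrafilter_def eventually_principal principal_eq_bot_iff)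
next
  case (Cons a \<sigma>)
  then show ?case by (simp add: uf_add_in_beta_Z uf_scale_in_beta_Z)
qed

end

theory Submission
  imports Defs "HOL-Library.Sublist"
begin

text \<open>
  If \<open>\<bar>c\<bar> = \<bar>d\<bar> = 1\<close>, the equation says, up to the order of its variables, that one of the numbers is
  the sum of the two others, so the string \<open>(1)\<close> works: a set in an idempotent ultrafilter contains
  \<open>a\<close>, \<open>b\<close> and \<open>a + b\<close> (\<open>idempotent_uf_Schur_triple\<close>).

  Conversely, one well-chosen idempotent \<open>U\<close> rules out every other pair of coefficients for a given
  \<open>\<sigma>\<close>. Fix a base \<open>B\<close> that is large compared with \<open>c\<close>, \<open>d\<close> and the entries of \<open>\<sigma>\<close>, and let \<open>U\<close>
  be idempotent and contain, for every \<open>m\<close>, the set of all sums of distinct powers \<open>B ^ i\<close> with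
  \<open>i \<ge> m\<close>. Then \<open>\<sigma>U\<close> contains the set of the integers with a base \<open>B\<close> expansion, negative digits
  included, that after deletion of the zeros and contraction of runs of equal digits is exactly \<open>\<sigma>\<close> (\<open>word_in_string_uf\<close>); this is
  where \<open>\<sigma>\<close> has to be reduced. As \<open>B\<close> is large, no carries occur, and a solution of the equation in
  this set solves it digit by digit (\<open>digitwise_equation\<close>). Three words \<open>x\<close>, \<open>y\<close>, \<open>z\<close> with the same
  pattern \<open>\<sigma>\<close> and \<open>c(x\<^sub>i - y\<^sub>i) + d z\<^sub>i = 0\<close> for all \<open>i\<close> force \<open>\<bar>c\<bar> = \<bar>d\<bar> = 1\<close>
  (\<open>unit_coefficients_if_digitwise_solution\<close>), for the following reasons.

  Let \<open>g\<close> be the greatest common divisor of the entries of \<open>\<sigma>\<close>. It divides every \<open>x\<^sub>i - y\<^sub>i\<close>, and \<open>c\<close> is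
  coprime to \<open>d\<close>, so \<open>c g\<close> divides every \<open>z\<^sub>i\<close>, that is, every entry of \<open>\<sigma>\<close>. Hence \<open>c g\<close> divides \<open>g\<close>
  and \<open>\<bar>c\<bar> = 1\<close>.

  Let \<open>M\<close> be the largest absolute value of an entry of \<open>\<sigma>\<close>. Where \<open>\<bar>z\<^sub>i\<bar> = M\<close>, the equation gives
  \<open>\<bar>d\<bar> M = \<bar>x\<^sub>i - y\<^sub>i\<bar> \<le> 2 M\<close>. So if \<open>\<bar>d\<bar> \<noteq> 1\<close>, then \<open>\<bar>d\<bar> = 2\<close> and one of the words \<open>x\<close>, \<open>y\<close>,
  the same one at all these positions, has the digit \<open>- z\<^sub>i\<close> there. This is impossible: both words
  have the same number of runs of the digits \<open>M\<close> and \<open>- M\<close>, both start with a run of the same sign,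
  and the word with the opposite digits would have to add its first run before it mirrors all the
  runs of \<open>z\<close> (\<open>no_opposite_words_with_same_pattern\<close>).

  The existence of \<open>U\<close> is the Ellis--Numakura lemma, carried out with filters in place of closed
  sets of ultrafilters (\<open>idempotent_ultrafilter_below_additive_filter\<close>).
\<close>

section \<open>Idempotent ultrafilters below a filter\<close>

lemma uf_add_mono: "F \<le> F' \<Longrightarrow> G \<le> G' \<Longrightarrow> F \<oplus>\<^sub>\<beta> G \<le> F' \<oplus>\<^sub>\<beta> G'"
  unfolding le_filter_def eventually_uf_add by (metis (mono_tags, lifting) eventually_mono)

text \<open>
  Ultrafilters are the atoms of the lattice of filters, in which smaller means finer.
\<close>

lemma ultrafilter_le_eq:
  assumes "ultrafilter U" "F \<noteq> bot" "F \<le> U"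
  shows "F = U"
proof (rule antisym[OF assms(3)], rule filter_leI)
  fix P assume P: "eventually P F"
  show "eventually P U"
  proof (rule ccontr)
    assume "\<not> eventually P U"
    then have "eventually (\<lambda>x. \<not> P x) F"
      using assms(1,3) by (auto simp: ultrafilter_def le_filter_def)
    with P have "eventually (\<lambda>_. False) F" by eventually_elim simp
    with assms(2) show False by (simp add: trivial_limit_def)
  qed
qed

text \<open>
  Zorn's lemma for filters. It is used both for the existence of ultrafilters, which are the minimal
  proper filters, and for the minimal closed semigroup in the Ellis--Numakura argument.
\<close>

lemma minimal_filter_exists:
  fixes F\<^sub>0 :: "'a filter"
  assumes "Q F\<^sub>0"
    and Inf: "\<And>C. C \<noteq> {} \<Longrightarrow> (\<And>F G. F \<in> C \<Longrightarrow> G \<in> C \<Longrightarrow> F \<le> G \<or> G \<le> F) \<Longrightarrow>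
                 (\<And>F. F \<in> C \<Longrightarrow> Q F) \<Longrightarrow> Q (Inf C)"
  obtains F where "F \<le> F\<^sub>0" "Q F" "\<And>G. G \<le> F \<Longrightarrow> Q G \<Longrightarrow> G = F"
proof -
  let ?A = "{F. Q F \<and> F \<le> F\<^sub>0}"
  have "\<exists>m\<in>?A. \<forall>a\<in>?A. a \<le> m \<longrightarrow> a = m"
  proof (rule predicate_Zorn)
    show "partial_order_on ?A (relation_of (\<lambda>F G. G \<le> F) ?A)"
      by (rule partial_order_on_relation_ofI) auto
  next
    fix C assume C: "C \<in> Chains (relation_of (\<lambda>F G. G \<le> F) ?A)"
    then have sub: "C \<subseteq> ?A" by (rule Chains_relation_of)
    show "\<exists>u\<in>?A. \<forall>a\<in>C. u \<le> a"
    proof (cases "C = {}")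
      case True
      then show ?thesis using assms(1) by auto
    next
      case False
      moreover have "F \<le> G \<or> G \<le> F" if "F \<in> C" "G \<in> C" for F G
        using C that by (auto simp: Chains_def relation_of_def)
      ultimately have "Q (Inf C)" using sub by (intro Inf) auto
      moreover have "Inf C \<le> F\<^sub>0" using False sub by (blast intro: Inf_lower2)
      ultimately show ?thesis by (auto intro: Inf_lower)
    qed
  qed
  then show thesis by (auto intro: that dest: order_trans)
qed

text \<open>
  A set that belongs to the infimum of a chain of filters already belongs to one of them. For the
  empty set this is the compactness of the space of ultrafilters.
\<close>

lemma Inf_chain_not_bot:
  fixes C :: "'a filter set"
  assumes "C \<noteq> {}" "\<And>F G. F \<in> C \<Longrightarrow> G \<in> C \<Longrightarrow> F \<le> G \<or> G \<le> F" "\<And>F. F \<in> C \<Longrightarrow> F \<noteq> bot"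
  shows "Inf C \<noteq> bot"
proof -
  have "eventually (\<lambda>_. False) (Inf C) \<longleftrightarrow> (\<exists>F\<in>C. eventually (\<lambda>_. False) F)"
    by (rule eventually_Inf_base) (use assms(1,2) in \<open>force simp: inf.absorb1 inf.absorb2\<close>)+
  then show ?thesis using assms(3) by (auto simp: trivial_limit_def)
qed

lemma ultrafilter_below:
  assumes "(F :: 'a filter) \<noteq> bot"
  obtains U where "ultrafilter U" "U \<le> F"
proof -
  obtain U where U: "U \<le> F" "U \<noteq> bot" and min: "\<And>G. G \<le> U \<Longrightarrow> G \<noteq> bot \<Longrightarrow> G = U"
  proof (rule minimal_filter_exists[of "\<lambda>F. F \<noteq> bot" F])
    show "F \<noteq> bot" by (rule assms)
    show "Inf C \<noteq> bot"
      if "C \<noteq> {}" "\<And>F G. F \<in> C \<Longrightarrow> G \<in> C \<Longrightarrow> F \<le> G \<or> G \<le> F" "\<And>F. F \<in> C \<Longrightarrow> F \<noteq> bot"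
      for C :: "'a filter set"
      using that by (rule Inf_chain_not_bot)
  qed blast
  have decides: "eventually P U \<or> eventually (\<lambda>x. \<not> P x) U" for P
  proof (cases "inf U (principal {x. P x}) = bot")
    case True
    then show ?thesis by (simp add: trivial_limit_def eventually_inf_principal)
  next
    case False
    then have "inf U (principal {x. P x}) = U" by (intro min) auto
    moreover have "eventually P (inf U (principal {x. P x}))"
      by (simp add: eventually_inf_principal)
    ultimately show ?thesis by simp
  qed
  have "ultrafilter U" using U(2) decides by (simp add: ultrafilter_def)
  then show thesis using U(1) by (rule that)
qed

text \<open>
  A filter \<open>F\<close> stands for the closed set of the ultrafilters \<open>V \<le> F\<close>, and \<open>F \<oplus>\<^sub>\<beta> V\<close> for its
  translate by \<open>V\<close>. Under this correspondence the additive filters are the non-empty closed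
  subsemigroups.
\<close>

definition additive_filter :: "int filter \<Rightarrow> bool" where
  "additive_filter F \<longleftrightarrow> F \<noteq> bot \<and> (\<forall>V. ultrafilter V \<and> V \<le> F \<longrightarrow> F \<oplus>\<^sub>\<beta> V \<le> F)"

text \<open>
  For an ultrafilter \<open>V\<close>, this filter stands for the closed set of all solutions \<open>W \<le> F\<close> of
  \<open>W \<oplus>\<^sub>\<beta> U = V\<close>: the filter \<open>F\<close> is refined by the sets of all \<open>n\<close> such that \<open>A - n\<close> belongs to \<open>U\<close>,
  where \<open>A\<close> runs over \<open>V\<close>.
\<close>

definition left_quotient_filter :: "int filter \<Rightarrow> int filter \<Rightarrow> int filter \<Rightarrow> int filter" where
  "left_quotient_filter F U V =
     Abs_filter (\<lambda>P. \<exists>A. eventually A V \<and> (\<forall>\<^sub>F n in F. (\<forall>\<^sub>F k in U. A (n + k)) \<longrightarrow> P n))"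

lemma eventually_left_quotient_filter:
  "eventually P (left_quotient_filter F U V) \<longleftrightarrow>
     (\<exists>A. eventually A V \<and> (\<forall>\<^sub>F n in F. (\<forall>\<^sub>F k in U. A (n + k)) \<longrightarrow> P n))"
  unfolding left_quotient_filter_def
proof (rule eventually_Abs_filter, rule is_filter.intro)
  show "\<exists>A. eventually A V \<and> (\<forall>\<^sub>F n in F. (\<forall>\<^sub>F k in U. A (n + k)) \<longrightarrow> True)"
    by (auto intro: exI[of _ "\<lambda>_. True"])
next
  fix P Q :: "int \<Rightarrow> bool"
  assume "\<exists>A. eventually A V \<and> (\<forall>\<^sub>F n in F. (\<forall>\<^sub>F k in U. A (n + k)) \<longrightarrow> P n)"
    "\<exists>A. eventually A V \<and> (\<forall>\<^sub>F n in F. (\<forall>\<^sub>F k in U. A (n + k)) \<longrightarrow> Q n)"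
  then obtain A B where A: "eventually A V" "\<forall>\<^sub>F n in F. (\<forall>\<^sub>F k in U. A (n + k)) \<longrightarrow> P n"
    and B: "eventually B V" "\<forall>\<^sub>F n in F. (\<forall>\<^sub>F k in U. B (n + k)) \<longrightarrow> Q n" by blast
  have "eventually (\<lambda>x. A x \<and> B x) V" using A(1) B(1) by (rule eventually_conj)
  moreover from A(2) B(2)
  have "\<forall>\<^sub>F n in F. (\<forall>\<^sub>F k in U. A (n + k) \<and> B (n + k)) \<longrightarrow> P n \<and> Q n"
    by eventually_elim (auto simp: eventually_conj_iff)
  ultimately
  show "\<exists>A. eventually A V \<and> (\<forall>\<^sub>F n in F. (\<forall>\<^sub>F k in U. A (n + k)) \<longrightarrow> P n \<and> Q n)"
    by blast
next
  fix P Q :: "int \<Rightarrow> bool"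
  assume PQ: "\<forall>x. P x \<longrightarrow> Q x"
    and "\<exists>A. eventually A V \<and> (\<forall>\<^sub>F n in F. (\<forall>\<^sub>F k in U. A (n + k)) \<longrightarrow> P n)"
  then show "\<exists>A. eventually A V \<and> (\<forall>\<^sub>F n in F. (\<forall>\<^sub>F k in U. A (n + k)) \<longrightarrow> Q n)"
    by (auto elim!: eventually_mono)
qed

lemma left_quotient_filter_le: "left_quotient_filter F U V \<le> F"
  by (rule filter_leI)
    (auto simp: eventually_left_quotient_filter intro: exI[of _ "\<lambda>_. True"] elim: eventually_mono)

lemma left_quotient_filter_add_le: "left_quotient_filter F U V \<oplus>\<^sub>\<beta> U \<le> V"
  by (rule filter_leI) (auto simp: eventually_left_quotient_filter eventually_uf_add)

text \<open>
  The solutions exist as soon as \<open>V\<close> lies in the translate of \<open>F\<close> by \<open>U\<close>: otherwise some \<open>A\<close> in \<open>V\<close>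
  has \<open>A - n\<close> outside the ultrafilter \<open>U\<close> for \<open>F\<close>-almost all \<open>n\<close>, so the complement of \<open>A\<close> belongs to
  \<open>F \<oplus>\<^sub>\<beta> U\<close> and hence to \<open>V\<close>.
\<close>

lemma left_quotient_filter_not_bot:
  assumes "ultrafilter U" "V \<noteq> bot" "V \<le> F \<oplus>\<^sub>\<beta> U"
  shows "left_quotient_filter F U V \<noteq> bot"
proof
  assume "left_quotient_filter F U V = bot"
  then obtain A where A: "eventually A V" "\<forall>\<^sub>F n in F. \<not> (\<forall>\<^sub>F k in U. A (n + k))"
    by (auto simp: trivial_limit_def eventually_left_quotient_filter)
  from A(2) have "\<forall>\<^sub>F n in F. \<forall>\<^sub>F k in U. \<not> A (n + k)"
    by eventually_elim (use assms(1) in \<open>auto simp: ultrafilter_def\<close>)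
  then have "eventually (\<lambda>x. \<not> A x) V"
    using assms(3) by (simp add: le_filter_def eventually_uf_add)
  with A(1) have "eventually (\<lambda>_. False) V" by eventually_elim simp
  with assms(2) show False by (simp add: trivial_limit_def)
qed

lemma uf_add_not_bot: "F \<noteq> bot \<Longrightarrow> G \<noteq> bot \<Longrightarrow> F \<oplus>\<^sub>\<beta> G \<noteq> bot"
  by (simp add: trivial_limit_def eventually_uf_add)

text \<open>
  This is the argument of Ellis and Numakura. Take a minimal additive filter \<open>F\<close> and an ultrafilter \<open>U\<close> below
  it. The translate \<open>F \<oplus>\<^sub>\<beta> U\<close> is again additive, so it is \<open>F\<close> by minimality. Therefore \<open>U\<close> itself
  lies in the translate, and the equation \<open>W \<oplus>\<^sub>\<beta> U = U\<close> has solutions \<open>W \<le> F\<close>. These form a closed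
  subsemigroup, which is everything by minimality; so \<open>W = U\<close> is a solution.
\<close>

lemma idempotent_ultrafilter_below_additive_filter:
  assumes "additive_filter F\<^sub>0"
  obtains U where "U \<in> beta_Z" "idempotent_uf U" "U \<le> F\<^sub>0"
proof -
  obtain F where F: "F \<le> F\<^sub>0" "additive_filter F"
    and min: "\<And>G. G \<le> F \<Longrightarrow> additive_filter G \<Longrightarrow> G = F"
  proof (rule minimal_filter_exists[of additive_filter F\<^sub>0])
    fix C assume C: "C \<noteq> {}" "\<And>F G. F \<in> C \<Longrightarrow> G \<in> C \<Longrightarrow> F \<le> G \<or> G \<le> F"
      "\<And>F. F \<in> C \<Longrightarrow> additive_filter F"
    have "Inf C \<noteq> bot"
      using C by (intro Inf_chain_not_bot) (auto simp: additive_filter_def)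
    moreover have "Inf C \<oplus>\<^sub>\<beta> V \<le> Inf C" if V: "ultrafilter V" "V \<le> Inf C" for V
    proof (rule Inf_greatest)
      fix F assume F: "F \<in> C"
      then have "Inf C \<oplus>\<^sub>\<beta> V \<le> F \<oplus>\<^sub>\<beta> V" by (intro uf_add_mono Inf_lower order_refl)
      also have "\<dots> \<le> F" using C(3)[OF F] V F by (auto simp: additive_filter_def le_Inf_iff)
      finally show "Inf C \<oplus>\<^sub>\<beta> V \<le> F" .
    qed
    ultimately show "additive_filter (Inf C)" by (simp add: additive_filter_def)
  qed (use assms in auto)
  obtain U where U: "ultrafilter U" "U \<le> F"
    using F(2) ultrafilter_below unfolding additive_filter_def by blast
  have U_bot: "U \<noteq> bot" using U(1) by (simp add: ultrafilter_def)
  have FU_le: "F \<oplus>\<^sub>\<beta> U \<le> F" using F(2) U by (auto simp: additive_filter_def)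
  have "additive_filter (F \<oplus>\<^sub>\<beta> U)"
    unfolding additive_filter_def
  proof (intro conjI allI impI)
    show "F \<oplus>\<^sub>\<beta> U \<noteq> bot"
      using F(2) U_bot by (intro uf_add_not_bot) (auto simp: additive_filter_def)
  next
    fix V assume V: "ultrafilter V \<and> V \<le> F \<oplus>\<^sub>\<beta> U"
    then have "left_quotient_filter F U V \<noteq> bot"
      using U(1) by (intro left_quotient_filter_not_bot) (auto simp: ultrafilter_def)
    \<comment> \<open>Writing \<open>V\<close> as \<open>W \<oplus>\<^sub>\<beta> U\<close> with \<open>W \<le> F\<close> reduces the claim to the additivity of \<open>F\<close>.\<close>
    then obtain W where W: "ultrafilter W" "W \<le> left_quotient_filter F U V"
      by (rule ultrafilter_below)
    have "W \<oplus>\<^sub>\<beta> U \<le> V"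
      using uf_add_mono[OF W(2) order_refl] left_quotient_filter_add_le by (rule order_trans)
    moreover have "W \<oplus>\<^sub>\<beta> U \<noteq> bot"
      using W(1) U_bot by (intro uf_add_not_bot) (auto simp: ultrafilter_def)
    ultimately have V_eq: "V = W \<oplus>\<^sub>\<beta> U" using V ultrafilter_le_eq by metis
    have WF: "W \<le> F" using W(2) left_quotient_filter_le by (rule order_trans)
    have "(F \<oplus>\<^sub>\<beta> U) \<oplus>\<^sub>\<beta> V = ((F \<oplus>\<^sub>\<beta> U) \<oplus>\<^sub>\<beta> W) \<oplus>\<^sub>\<beta> U" by (simp add: V_eq uf_add_assoc)
    also have "\<dots> \<le> (F \<oplus>\<^sub>\<beta> W) \<oplus>\<^sub>\<beta> U" using FU_le by (intro uf_add_mono order_refl)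
    also have "\<dots> \<le> F \<oplus>\<^sub>\<beta> U"
      using F(2) W(1) WF by (intro uf_add_mono order_refl) (auto simp: additive_filter_def)
    finally show "(F \<oplus>\<^sub>\<beta> U) \<oplus>\<^sub>\<beta> V \<le> F \<oplus>\<^sub>\<beta> U" .
  qed
  with FU_le have FU: "F \<oplus>\<^sub>\<beta> U = F" by (rule min)
  let ?G = "left_quotient_filter F U U"
  have "additive_filter ?G"
    unfolding additive_filter_def
  proof (intro conjI allI impI)
    show "?G \<noteq> bot" using U U_bot by (intro left_quotient_filter_not_bot) (auto simp: FU)
  next
    fix V assume V: "ultrafilter V \<and> V \<le> ?G"
    then have "V \<le> F" using left_quotient_filter_le order_trans by blast
    with V have GV_le: "?G \<oplus>\<^sub>\<beta> V \<le> F"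
      using F(2) uf_add_mono[OF left_quotient_filter_le order_refl, of F U U V]
      unfolding additive_filter_def by (blast intro: order_trans)
    have "V \<oplus>\<^sub>\<beta> U \<le> U"
      using V uf_add_mono[OF _ order_refl, of V ?G U] left_quotient_filter_add_le[of F U U]
      by (blast intro: order_trans)
    have "?G \<oplus>\<^sub>\<beta> V \<oplus>\<^sub>\<beta> U \<le> U"
    proof -
      have "?G \<oplus>\<^sub>\<beta> V \<oplus>\<^sub>\<beta> U = ?G \<oplus>\<^sub>\<beta> (V \<oplus>\<^sub>\<beta> U)" by (rule uf_add_assoc)
      also have "\<dots> \<le> ?G \<oplus>\<^sub>\<beta> U" using \<open>V \<oplus>\<^sub>\<beta> U \<le> U\<close> by (intro uf_add_mono order_refl)
      also have "\<dots> \<le> U" by (rule left_quotient_filter_add_le)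
      finally show ?thesis .
    qed
    show "?G \<oplus>\<^sub>\<beta> V \<le> ?G"
    proof (rule filter_leI)
      fix P assume "eventually P ?G"
      then obtain A where A: "eventually A U" "\<forall>\<^sub>F n in F. (\<forall>\<^sub>F k in U. A (n + k)) \<longrightarrow> P n"
        by (auto simp: eventually_left_quotient_filter)
      have "\<forall>\<^sub>F n in ?G \<oplus>\<^sub>\<beta> V. \<forall>\<^sub>F k in U. A (n + k)"
        using \<open>?G \<oplus>\<^sub>\<beta> V \<oplus>\<^sub>\<beta> U \<le> U\<close> A(1)
        unfolding eventually_uf_add[of A, symmetric] by (auto simp: le_filter_def)
      moreover have "\<forall>\<^sub>F n in ?G \<oplus>\<^sub>\<beta> V. (\<forall>\<^sub>F k in U. A (n + k)) \<longrightarrow> P n"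
        using GV_le A(2) by (rule filter_leD)
      ultimately show "eventually P (?G \<oplus>\<^sub>\<beta> V)" by eventually_elim simp
    qed
  qed
  with left_quotient_filter_le have "?G = F" by (rule min)
  then have "U \<oplus>\<^sub>\<beta> U \<le> U"
    using uf_add_mono[OF U(2) order_refl, of U] left_quotient_filter_add_le[of F U U] by auto
  then have "idempotent_uf U"
    unfolding idempotent_uf_def using U(1) U_bot by (intro ultrafilter_le_eq uf_add_not_bot)
  with U F(1) show thesis by (intro that[of U]) (auto simp: beta_Z_def)
qed


section \<open>Words of digits and their patterns\<close>

text \<open>
  Words are lists of digits, the least significant digit first; the digits may be negative.
\<close>

abbreviation word_value :: "int \<Rightarrow> int list \<Rightarrow> int" where
  "word_value B w \<equiv> horner_sum (\<lambda>a. a) B w"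

definition word_pattern :: "int list \<Rightarrow> int list" where
  "word_pattern w = remdups_adj (filter (\<lambda>a. a \<noteq> 0) w)"

lemma word_value_append:
  "word_value B (v @ w) = word_value B v + B ^ length v * word_value B w"
  by (induction v) (auto simp: algebra_simps)

lemma word_value_map_mult: "word_value B (map ((*) a) w) = a * word_value B w"
  by (induction w) (auto simp: algebra_simps)

lemma word_value_zeros [simp]: "word_value B (replicate k 0) = 0"
  by (induction k) auto

lemma word_pattern_append_zeros [simp]: "word_pattern (w @ replicate k 0) = word_pattern w"
  by (simp add: word_pattern_def)

lemma set_word_pattern: "set (word_pattern w) = set w - {0}"
  by (auto simp: word_pattern_def)

text \<open>
  The word in front contributes a single run of the digit \<open>a\<close>, up to zeros. It does not merge with the
  first run of \<open>w\<close> because adjacent entries of a reduced string differ.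
\<close>

lemma word_pattern_scaled_binary:
  assumes "set v \<subseteq> {0, 1}" "1 \<in> set v" "reduced_string (a # \<sigma>)" "word_pattern w = \<sigma>"
  shows "word_pattern (map ((*) a) v @ w) = a # \<sigma>"
proof -
  let ?nz = "filter (\<lambda>x. x \<noteq> (0 :: int))"
  have a: "a \<noteq> 0" using assms(3) by (simp add: reduced_string_def)
  have "?nz (map ((*) a) v) = replicate (length (?nz v)) a"
    using assms(1) a by (induction v) auto
  moreover have "?nz v \<noteq> []" using assms(2) by (force simp: filter_empty_conv)
  ultimately obtain j where j: "?nz (map ((*) a) v) = replicate (Suc j) a"
    by (metis length_0_conv not0_implies_Suc)
  have "?nz w = [] \<or> hd (?nz w) \<noteq> a"
    using assms(3,4) hd_remdups_adj[of "?nz w"]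
    by (cases \<sigma>) (auto simp: word_pattern_def reduced_string_def)
  moreover have "remdups_adj (replicate (Suc j) a @ u) = a # remdups_adj u"
    if "u = [] \<or> hd u \<noteq> a" for u
  proof (induction j)
    case 0
    then show ?case using that by (cases u) auto
  qed simp
  ultimately show ?thesis using assms(4) j by (simp add: word_pattern_def)
qed

text \<open>
  An element of \<open>aU\<close> is fixed first, and the element of the remaining sum can then be chosen divisible by
  a power of \<open>B\<close> beyond all its digits. So the words are concatenated without overlap. The
  factor \<open>B ^ m\<close> is what makes the induction possible.
\<close>

lemma word_in_string_uf:
  assumes U: "\<And>m. \<forall>\<^sub>F n in U. \<exists>v. set v \<subseteq> {0, 1} \<and> 1 \<in> set v \<and> n = B ^ m * word_value B v"
    and "reduced_string \<sigma>"
  shows "\<forall>\<^sub>F n in string_uf \<sigma> U. \<exists>w. word_pattern w = \<sigma> \<and> n = B ^ m * word_value B w"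
  using assms(2)
proof (induction \<sigma> arbitrary: m)
  case Nil
  then show ?case
    by (auto simp: eventually_principal word_pattern_def intro!: exI[of _ "[]"])
next
  case (Cons a \<sigma>)
  have red: "reduced_string \<sigma>"
    using Cons.prems by (cases \<sigma>) (auto simp: reduced_string_def)
  have "\<forall>\<^sub>F n in U. \<forall>\<^sub>F k in string_uf \<sigma> U.
          \<exists>w. word_pattern w = a # \<sigma> \<and> a * n + k = B ^ m * word_value B w"
    using U[of m]
  proof eventually_elim
    case (elim n)
    then obtain v where v: "set v \<subseteq> {0, 1}" "1 \<in> set v" "n = B ^ m * word_value B v" by blast
    show ?case
      using Cons.IH[OF red, of "m + length v"]
    proof eventually_elim
      case (elim k)
      then obtain w where w: "word_pattern w = \<sigma>" "k = B ^ (m + length v) * word_value B w"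
        by blast
      have "word_pattern (map ((*) a) v @ w) = a # \<sigma>"
        using v(1,2) Cons.prems w(1) by (rule word_pattern_scaled_binary)
      moreover have "a * n + k = B ^ m * word_value B (map ((*) a) v @ w)"
        by (simp add: v(3) w(2) word_value_append word_value_map_mult power_add algebra_simps)
      ultimately show ?case by blast
    qed
  qed
  then show ?case by (simp add: eventually_uf_add uf_scale_def eventually_filtermap)
qed

text \<open>
  The numbers \<open>B ^ m * word_value B v\<close>, with \<open>v\<close> binary and not zero, are the non-empty finite sums of
  powers \<open>B ^ i\<close> with distinct exponents \<open>i \<ge> m\<close>. These sets generate an additive filter: adding to such a sum an
  element with much larger exponents gives another one.
\<close>

lemma idempotent_ultrafilter_of_binary_words:
  obtains U where "U \<in> beta_Z" "idempotent_uf U"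
    "\<And>m. \<forall>\<^sub>F n in U. \<exists>v. set v \<subseteq> {0, 1} \<and> 1 \<in> set v \<and> n = B ^ m * word_value B v"
proof -
  define FS where
    "FS m = {B ^ m * word_value B v | v. set v \<subseteq> {0, 1} \<and> 1 \<in> set v}" for m
  define F where "F = (INF m. principal (FS m))"
  have FS_Suc: "FS (Suc m) \<subseteq> FS m" for m
  proof
    fix n assume "n \<in> FS (Suc m)"
    then obtain v where "set v \<subseteq> {0, 1}" "1 \<in> set v" "n = B ^ Suc m * word_value B v"
      by (auto simp: FS_def)
    then show "n \<in> FS m"
      unfolding FS_def by (intro CollectI exI[of _ "0 # v"]) auto
  qed
  then have anti: "antimono FS" by (simp add: decseq_Suc_iff)
  have ev: "eventually P F \<longleftrightarrow> (\<exists>m. \<forall>n\<in>FS m. P n)" for P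
    unfolding F_def
  proof (subst eventually_INF_base)
    fix i j :: nat
    show "\<exists>k\<in>UNIV. principal (FS k) \<le> inf (principal (FS i)) (principal (FS j))"
      using anti by (intro bexI[of _ "max i j"]) (auto simp: antimono_def)
  qed (auto simp: eventually_principal)
  have "additive_filter F"
    unfolding additive_filter_def
  proof (intro conjI allI impI)
    have "FS m \<noteq> {}" for m
      unfolding FS_def by (auto intro!: exI[of _ "[1]"])
    then show "F \<noteq> bot" by (auto simp: trivial_limit_def ev)
  next
    fix V assume V: "ultrafilter V \<and> V \<le> F"
    show "F \<oplus>\<^sub>\<beta> V \<le> F"
    proof (rule filter_leI)
      fix P assume "eventually P F"
      then obtain m where m: "\<And>n. n \<in> FS m \<Longrightarrow> P n" by (auto simp: ev)
      have "\<forall>\<^sub>F k in V. P (n + k)" if n: "n \<in> FS m" for n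
      proof -
        obtain v where v: "set v \<subseteq> {0, 1}" "1 \<in> set v" "n = B ^ m * word_value B v"
          using n by (auto simp: FS_def)
        have "\<forall>\<^sub>F k in F. k \<in> FS (m + length v)" by (auto simp: ev)
        then have "\<forall>\<^sub>F k in V. k \<in> FS (m + length v)" using V by (auto simp: le_filter_def)
        then show ?thesis
        proof eventually_elim
          case (elim k)
          then obtain w where w: "set w \<subseteq> {0, 1}" "k = B ^ (m + length v) * word_value B w"
            by (auto simp: FS_def)
          have "n + k = B ^ m * word_value B (v @ w)"
            by (simp add: v(3) w(2) word_value_append power_add algebra_simps)
          then have "n + k \<in> FS m"
            unfolding FS_def using v w by (intro CollectI exI[of _ "v @ w"]) auto
          then show ?case by (rule m)
        qed
      qed
      then show "eventually P (F \<oplus>\<^sub>\<beta> V)" by (auto simp: ev eventually_uf_add)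
    qed
  qed
  then obtain U where U: "U \<in> beta_Z" "idempotent_uf U" "U \<le> F"
    by (rule idempotent_ultrafilter_below_additive_filter)
  have "\<forall>\<^sub>F n in F. n \<in> FS m" for m by (auto simp: ev)
  then have "\<forall>\<^sub>F n in U. n \<in> FS m" for m using U(3) by (auto simp: le_filter_def)
  then show thesis using U(1,2) by (intro that[of U]) (auto simp: FS_def conj_ac)
qed


section \<open>The equation read digit by digit\<close>

text \<open>
  The first digit of the combined word is divisible by \<open>B\<close> and smaller than \<open>B\<close> in absolute value, so it vanishes, and
  the remaining word again has value \<open>0\<close>.
\<close>

lemma digitwise_equation:
  fixes B :: int
  assumes "length xs = length ys" "length ys = length zs"
    and "c * (word_value B xs - word_value B ys) + d * word_value B zs = 0"
    and "\<forall>i<length zs. \<bar>c * (xs ! i - ys ! i) + d * zs ! i\<bar> < B"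
  shows "\<forall>i<length zs. c * (xs ! i - ys ! i) + d * zs ! i = 0"
  using assms
proof (induction xs ys zs rule: list_induct3)
  case Nil
  then show ?case by simp
next
  case (Cons x xs y ys z zs)
  let ?e = "c * (x - y) + d * z"
  let ?r = "c * (word_value B xs - word_value B ys) + d * word_value B zs"
  have e: "?e + B * ?r = 0" using Cons.prems(1) by (simp add: algebra_simps)
  have bound: "\<bar>?e\<bar> < B" using Cons.prems(2) by (auto dest: spec[of _ 0])
  from e have "B dvd ?e" by (metis add.commute dvd_add_times_triv_left_iff dvd_0_right mult.commute)
  with bound have e0: "?e = 0" using zdvd_imp_le[of B "\<bar>?e\<bar>"] by fastforce
  with e bound have "?r = 0" by simp
  moreover have "\<forall>i<length zs. \<bar>c * (xs ! i - ys ! i) + d * zs ! i\<bar> < B"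
    using Cons.prems(2) by (auto dest: spec[of _ "Suc _"])
  ultimately have "\<forall>i<length zs. c * (xs ! i - ys ! i) + d * zs ! i = 0" by (rule Cons.IH)
  with e0 show ?case by (auto simp: nth_Cons split: nat.split)
qed

lemma remdups_adj_filter_remdups_adj:
  "remdups_adj (filter P (remdups_adj w)) = remdups_adj (filter P w)"
proof (induction w rule: remdups_adj.induct)
  case (3 x y xs)
  have cong: "remdups_adj (x # u) = remdups_adj (x # v)"
    if "remdups_adj u = remdups_adj v" for u v
    using that by (simp add: remdups_adj_Cons)
  show ?case
  proof (cases "x = y")
    case True
    then show ?thesis using "3.IH"(1) by simp
  next
    case False
    then show ?thesis using "3.IH"(2) cong[OF "3.IH"(2)] by simp
  qed
qed simp_all

text \<open>
  So the pattern of a word determines the sequence of runs of any selection of its non-zero digits. It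
  is applied to the digits of largest absolute value.
\<close>

lemma remdups_adj_filter_eq_if_word_pattern_eq:
  assumes "word_pattern v = word_pattern w" "\<not> P 0"
  shows "remdups_adj (filter P v) = remdups_adj (filter P w)"
proof -
  have "remdups_adj (filter P u) = remdups_adj (filter P (word_pattern u))" for u
  proof -
    have "filter P u = filter P (filter (\<lambda>a. a \<noteq> 0) u)"
      using assms(2) by (auto intro!: filter_cong)
    then show ?thesis by (simp add: word_pattern_def remdups_adj_filter_remdups_adj)
  qed
  with assms(1) show ?thesis by metis
qed

text \<open>
  Passing to a subsequence cannot increase the number of runs. The common first entry \<open>x\<close> makes the
  induction work, since dropping an entry may merge its neighbours.
\<close>

lemma length_remdups_adj_subseq:
  "subseq u v \<Longrightarrow> length (remdups_adj (x # u)) \<le> length (remdups_adj (x # v))"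
proof (induction arbitrary: x rule: list_emb.induct)
  case (list_emb_Nil ys)
  then show ?case by (simp add: Suc_leI)
next
  case (list_emb_Cons u v y)
  have "length (remdups_adj (x # v)) \<le> length (remdups_adj (x # y # v))"
    by (cases v) auto
  with list_emb_Cons.IH[of x] show ?case by linarith
next
  case (list_emb_Cons2 a b u v)
  then show ?case by auto
qed

text \<open>
  The digits \<open>\<plusminus>M\<close> of both words have the same sequence of runs; let \<open>s\<close> be its first entry. Negated, those of
  \<open>zs\<close> form a subsequence of those of \<open>xs\<close>, and this subsequence starts with \<open>- s\<close> whereas \<open>xs\<close> starts
  with \<open>s\<close>. Putting \<open>s\<close> in front therefore gives one run more than \<open>zs\<close> has, without exceeding the
  number of runs of \<open>xs\<close>.
\<close>

lemma no_opposite_words_with_same_pattern: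
  assumes "list_all2 (\<lambda>x z. \<bar>z\<bar> = M \<longrightarrow> x = - z) xs zs" "M > 0"
    and "word_pattern xs = word_pattern zs" and "z \<in> set zs" "\<bar>z\<bar> = M"
  shows False
proof -
  let ?f = "filter (\<lambda>a. \<bar>a\<bar> = M)"
  have sub: "subseq (map uminus (?f zs)) (?f xs)"
    using assms(1) by (induction rule: list_all2_induct) auto
  have eq: "remdups_adj (?f xs) = remdups_adj (?f zs)"
    using assms(2,3) by (intro remdups_adj_filter_eq_if_word_pattern_eq) auto
  have "?f zs \<noteq> []" using assms(4,5) by (auto simp: filter_empty_conv)
  then obtain s zs' where zs': "?f zs = s # zs'" by (cases "?f zs") auto
  have "s \<in> set (?f zs)" by (simp only: zs' list.set_intros)
  then have "\<bar>s\<bar> = M" by simp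
  then have s: "- s \<noteq> s" using assms(2) by auto
  have "?f xs \<noteq> []" using eq zs' by (metis list.distinct(1) remdups_adj_Nil_iff)
  moreover have "hd (?f xs) = s" using eq zs' by (metis hd_remdups_adj list.sel(1))
  ultimately obtain xs' where xs': "?f xs = s # xs'" by (cases "?f xs") auto
  \<comment> \<open>Prepending \<open>s\<close> to \<open>?f xs\<close>, which starts with \<open>s\<close>, leaves its number of runs unchanged.\<close>
  have "Suc (length (remdups_adj (map uminus (?f zs)))) = length (remdups_adj (s # map uminus (?f zs)))"
    using s by (simp add: zs')
  also have "\<dots> \<le> length (remdups_adj (s # ?f xs))"
    using sub by (rule length_remdups_adj_subseq)
  also have "\<dots> = length (remdups_adj (?f zs))" using eq by (simp add: xs')
  also have "\<dots> = length (remdups_adj (map uminus (?f zs)))"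
    by (subst remdups_adj_map_injective) auto
  finally show False by simp
qed

text \<open>
  Divisibility by the greatest common divisor \<open>g\<close> of the letters settles \<open>c\<close>, and the positions of the letters of
  largest absolute value \<open>M\<close> in \<open>zs\<close> settle \<open>d\<close>.
\<close>

lemma unit_coefficients_if_digitwise_solution:
  fixes c d :: int
  assumes "gcd c d = 1" "d \<noteq> 0" "\<sigma> \<noteq> []"
    and len: "length xs = length zs" "length ys = length zs"
    and pat: "word_pattern xs = \<sigma>" "word_pattern ys = \<sigma>" "word_pattern zs = \<sigma>"
    and eq: "\<forall>i<length zs. c * (xs ! i - ys ! i) + d * zs ! i = 0"
  shows "\<bar>c\<bar> = 1 \<and> \<bar>d\<bar> = 1"
proof
  have letters: "set \<sigma> = set w - {0}" if "word_pattern w = \<sigma>" for w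
    using set_word_pattern that by blast
  define g where "g = Gcd (set \<sigma>)"
  have g_dvd: "g dvd a" if "a \<in> set w" "word_pattern w = \<sigma>" for a w
    using letters[OF that(2)] that(1) by (cases "a = 0") (auto simp: g_def)
  have "c * g dvd a" if a: "a \<in> set \<sigma>" for a
  proof -
    obtain i where i: "i < length zs" "zs ! i = a"
      using a letters[OF pat(3)] by (auto simp: in_set_conv_nth)
    have "g dvd xs ! i - ys ! i"
      using i len by (intro dvd_diff g_dvd[OF _ pat(1)] g_dvd[OF _ pat(2)]) auto
    then have "c * g dvd c * (xs ! i - ys ! i)" by (rule mult_dvd_mono[OF dvd_refl])
    moreover have "d * a = - (c * (xs ! i - ys ! i))" using eq i by (auto simp: eq_neg_iff_add_eq_0 add.commute)
    ultimately have "c * g dvd d * a" by simp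
    moreover obtain a' where "a = g * a'" using a by (auto simp: g_def elim: dvdE[OF Gcd_dvd])
    moreover have "g \<noteq> 0" using a letters[OF pat(3)] by (auto simp: g_def)
    ultimately have "c dvd d * a'" by (auto simp: algebra_simps)
    then have "c dvd a'" using assms(1) by (simp add: coprime_dvd_mult_right_iff coprime_iff_gcd_eq_1)
    with \<open>a = g * a'\<close> show ?thesis by auto
  qed
  then have "c * g dvd g" by (auto simp: g_def intro: Gcd_greatest)
  moreover have "g \<noteq> 0" using assms(3) letters[OF pat(3)] by (cases \<sigma>) (auto simp: g_def)
  ultimately show c: "\<bar>c\<bar> = 1" by (simp add: zdvd1_eq)
  define M where "M = Max (abs ` set \<sigma>)"
  have "M \<in> abs ` set \<sigma>" unfolding M_def using assms(3) by (intro Max_in) auto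
  then obtain a where a: "a \<in> set \<sigma>" "\<bar>a\<bar> = M" by auto
  have az: "a \<in> set zs" "a \<noteq> 0" using a(1) letters[OF pat(3)] by blast+
  then have M: "M > 0" using a(2) by linarith
  have le_M: "\<bar>b\<bar> \<le> M" if "b \<in> set w" "word_pattern w = \<sigma>" for b w
  proof (cases "b = 0")
    case False
    then have "\<bar>b\<bar> \<in> abs ` set \<sigma>" using letters[OF that(2)] that(1) by blast
    then show ?thesis unfolding M_def by (intro Max_ge) auto
  qed (use M in simp)
  have bounds: "\<bar>xs ! i\<bar> \<le> M" "\<bar>ys ! i\<bar> \<le> M" if "i < length zs" for i
    using that len by (auto intro: le_M[OF _ pat(1)] le_M[OF _ pat(2)])
  show "\<bar>d\<bar> = 1"
  proof (rule ccontr)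
    assume "\<bar>d\<bar> \<noteq> 1"
    with assms(2) have d2: "\<bar>d\<bar> \<ge> 2" by linarith
    \<comment> \<open>Where \<open>\<bar>zs ! i\<bar> = M\<close>, the difference of \<open>ys ! i\<close> and \<open>xs ! i\<close> is as large as it can be, so
      both digits are extremal.\<close>
    have opp: "c * xs ! i = - sgn d * zs ! i \<and> c * ys ! i = sgn d * zs ! i"
      if i: "i < length zs" "\<bar>zs ! i\<bar> = M" for i
    proof -
      let ?p = "c * xs ! i" and ?q = "c * ys ! i" and ?r = "sgn d * zs ! i"
      have M2: "2 * M \<le> \<bar>d\<bar> * M" using d2 M by simp
      have "\<bar>d\<bar> * ?r = d * zs ! i" by (simp add: mult.assoc[symmetric] abs_mult_sgn)
      moreover have "d * zs ! i = ?q - ?p" using eq i by (auto simp: algebra_simps)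
      ultimately have eqr: "\<bar>d\<bar> * ?r = ?q - ?p" by simp
      have pq: "\<bar>?p\<bar> \<le> M" "\<bar>?q\<bar> \<le> M" using bounds[OF i(1)] c by (simp_all add: abs_mult)
      have "\<bar>?r\<bar> = M" using i(2) assms(2) by (cases "d > 0") (simp_all add: sgn_if)
      then consider "?r = M" | "?r = - M" by linarith
      then have "?p = - ?r \<and> ?q = ?r"
      proof cases
        case 1
        then have "\<bar>d\<bar> * M = ?q - ?p" using eqr by simp
        with 1 M2 pq show ?thesis by linarith
      next
        case 2
        then have "\<bar>d\<bar> * M = ?p - ?q" using eqr by simp
        with 2 M2 pq show ?thesis by linarith
      qed
      then show ?thesis by simp
    qed
    have units: "c = 1 \<or> c = - 1" "sgn d = 1 \<or> sgn d = - 1"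
      using c assms(2) by (auto simp: sgn_if)
    \<comment> \<open>The signs of \<open>c\<close> and \<open>d\<close> decide which of \<open>xs\<close> and \<open>ys\<close> is opposite to \<open>zs\<close>.\<close>
    show False
    proof (cases "c = sgn d")
      case True
      have "xs ! i = - zs ! i" if "i < length zs" "\<bar>zs ! i\<bar> = M" for i
        using opp[OF that] units True by auto
      then have "list_all2 (\<lambda>x z. \<bar>z\<bar> = M \<longrightarrow> x = - z) xs zs"
        using len by (auto simp: list_all2_conv_all_nth)
      then show False
        using M trans[OF pat(1) pat(3)[symmetric]] az(1) a(2)
        by (rule no_opposite_words_with_same_pattern)
    next
      case False
      have "ys ! i = - zs ! i" if "i < length zs" "\<bar>zs ! i\<bar> = M" for i
        using opp[OF that] units False by auto
      then have "list_all2 (\<lambda>y z. \<bar>z\<bar> = M \<longrightarrow> y = - z) ys zs"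
        using len by (auto simp: list_all2_conv_all_nth)
      then show False
        using M trans[OF pat(2) pat(3)[symmetric]] az(1) a(2)
        by (rule no_opposite_words_with_same_pattern)
    qed
  qed
qed


section \<open>The equivalence\<close>

lemma unit_coefficients_if_satisfied_by_string:
  fixes c d :: int
  assumes "gcd c d = 1" "d \<noteq> 0" "\<sigma> \<noteq> []" "reduced_string \<sigma>"
    and sat: "\<And>U. U \<in> beta_Z \<Longrightarrow> idempotent_uf U \<Longrightarrow>
      uf_satisfies (string_uf \<sigma> U) 3 (\<lambda>b. c * (b ! 0 - b ! 1) + d * b ! 2)"
  shows "\<bar>c\<bar> = 1 \<and> \<bar>d\<bar> = 1"
proof -
  \<comment> \<open>\<open>B\<close> exceeds \<open>\<bar>c(x - y) + dz\<bar>\<close> whenever \<open>x\<close>, \<open>y\<close> and \<open>z\<close> are digits of absolute value at most \<open>M\<close>.\<close>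
  define M where "M = Max (insert 0 (abs ` set \<sigma>))"
  define B where "B = (2 * \<bar>c\<bar> + \<bar>d\<bar>) * M + 1"
  define A where "A = {word_value B w | w. word_pattern w = \<sigma>}"
  have le_M: "\<bar>a\<bar> \<le> M" if "a \<in> set w" "word_pattern w = \<sigma>" for a w
  proof -
    have "\<bar>a\<bar> \<in> insert 0 (abs ` set \<sigma>)" using that set_word_pattern[of w] by auto
    then show ?thesis unfolding M_def by (intro Max_ge) auto
  qed
  obtain U where U: "U \<in> beta_Z" "idempotent_uf U"
    "\<And>m. \<forall>\<^sub>F n in U. \<exists>v. set v \<subseteq> {0, 1} \<and> 1 \<in> set v \<and> n = B ^ m * word_value B v"
    by (rule idempotent_ultrafilter_of_binary_words[of B]) blast
  have "\<forall>\<^sub>F n in string_uf \<sigma> U. n \<in> A"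
    using word_in_string_uf[OF U(3) assms(4), of 0] by (auto simp: A_def conj_ac)
  then obtain bs where bs: "length bs = 3" "set bs \<subseteq> A" "c * (bs ! 0 - bs ! 1) + d * bs ! 2 = 0"
    using sat[OF U(1,2)] unfolding uf_satisfies_def by blast
  have "bs ! 0 \<in> A" "bs ! 1 \<in> A" "bs ! 2 \<in> A" using bs(1,2) by (auto simp: subset_iff)
  then obtain xs ys zs where w: "bs ! 0 = word_value B xs" "bs ! 1 = word_value B ys"
    "bs ! 2 = word_value B zs"
    "word_pattern xs = \<sigma>" "word_pattern ys = \<sigma>" "word_pattern zs = \<sigma>"
    unfolding A_def by blast
  \<comment> \<open>Leading zeros give the three words a common length without changing values or patterns.\<close>
  define N where "N = length xs + length ys + length zs"
  define pad where "pad u = u @ replicate (N - length u) 0" for u :: "int list"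
  have len: "length (pad xs) = N" "length (pad ys) = N" "length (pad zs) = N"
    by (auto simp: pad_def N_def)
  have pat: "word_pattern (pad xs) = \<sigma>" "word_pattern (pad ys) = \<sigma>" "word_pattern (pad zs) = \<sigma>"
    by (simp_all add: pad_def w)
  have "\<forall>i<length (pad zs). c * (pad xs ! i - pad ys ! i) + d * pad zs ! i = 0"
  proof (rule digitwise_equation[where B = B])
    show "c * (word_value B (pad xs) - word_value B (pad ys)) + d * word_value B (pad zs) = 0"
      using bs(3) unfolding w(1-3) by (simp add: pad_def word_value_append)
    show "\<forall>i<length (pad zs). \<bar>c * (pad xs ! i - pad ys ! i) + d * pad zs ! i\<bar> < B"
    proof (intro allI impI)
      fix i assume i: "i < length (pad zs)"
      have b: "\<bar>pad xs ! i\<bar> \<le> M" "\<bar>pad ys ! i\<bar> \<le> M" "\<bar>pad zs ! i\<bar> \<le> M"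
        using i len by (auto intro: le_M[OF _ pat(1)] le_M[OF _ pat(2)] le_M[OF _ pat(3)])
      have "\<bar>c * (pad xs ! i - pad ys ! i) + d * pad zs ! i\<bar>
              \<le> \<bar>c\<bar> * \<bar>pad xs ! i - pad ys ! i\<bar> + \<bar>d\<bar> * \<bar>pad zs ! i\<bar>"
        by (metis abs_mult abs_triangle_ineq)
      also have "\<dots> \<le> \<bar>c\<bar> * (2 * M) + \<bar>d\<bar> * M"
        using b by (intro add_mono mult_left_mono) auto
      also have "\<dots> < B" by (simp add: B_def algebra_simps)
      finally show "\<bar>c * (pad xs ! i - pad ys ! i) + d * pad zs ! i\<bar> < B" .
    qed
  qed (simp_all add: len)
  with assms(1-3) _ _ pat show ?thesis
    by (rule unit_coefficients_if_digitwise_solution) (simp_all add: len)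
qed

lemma idempotent_uf_Schur_triple:
  assumes "U \<in> beta_Z" "idempotent_uf U" "\<forall>\<^sub>F n in U. n \<in> A"
  obtains a b where "a \<in> A" "b \<in> A" "a + b \<in> A"
proof -
  have bot: "U \<noteq> bot" using assms(1) by (simp add: beta_Z_def ultrafilter_def)
  have "\<forall>\<^sub>F n in U. \<forall>\<^sub>F k in U. n + k \<in> A"
    using assms(2,3) by (simp add: idempotent_uf_def flip: eventually_uf_add[of "\<lambda>x. x \<in> A"])
  with assms(3) have "\<forall>\<^sub>F n in U. n \<in> A \<and> (\<forall>\<^sub>F k in U. n + k \<in> A)"
    by (rule eventually_conj)
  then obtain a where a: "a \<in> A" "\<forall>\<^sub>F k in U. a + k \<in> A"
    using bot eventually_happens' by blast
  from assms(3) a(2) have "\<forall>\<^sub>F k in U. k \<in> A \<and> a + k \<in> A" by (rule eventually_conj)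
  then obtain b where "b \<in> A" "a + b \<in> A" using bot eventually_happens' by blast
  with a(1) show thesis by (rule that)
qed

theorem corollary6p6:
  fixes c d :: int
  assumes "c \<noteq> 0" and "d \<noteq> 0" and "gcd c d = 1"
  shows "(\<exists>\<sigma> :: int list. \<sigma> \<noteq> [] \<and> reduced_string \<sigma> \<and>
            (\<forall>U\<in>beta_Z. idempotent_uf U \<longrightarrow>
               uf_satisfies (string_uf \<sigma> U) 3 (\<lambda>b. c * (b ! 0 - b ! 1) + d * b ! 2)))
         \<longleftrightarrow> \<bar>c\<bar> = 1 \<and> \<bar>d\<bar> = 1"
proof
  assume "\<exists>\<sigma> :: int list. \<sigma> \<noteq> [] \<and> reduced_string \<sigma> \<and>
            (\<forall>U\<in>beta_Z. idempotent_uf U \<longrightarrow>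
               uf_satisfies (string_uf \<sigma> U) 3 (\<lambda>b. c * (b ! 0 - b ! 1) + d * b ! 2))"
  then obtain \<sigma> :: "int list" where "\<sigma> \<noteq> []" "reduced_string \<sigma>"
    "\<And>U. U \<in> beta_Z \<Longrightarrow> idempotent_uf U \<Longrightarrow>
       uf_satisfies (string_uf \<sigma> U) 3 (\<lambda>b. c * (b ! 0 - b ! 1) + d * b ! 2)"
    by blast
  then show "\<bar>c\<bar> = 1 \<and> \<bar>d\<bar> = 1"
    by (rule unit_coefficients_if_satisfied_by_string[OF assms(3,2)])
next
  assume "\<bar>c\<bar> = 1 \<and> \<bar>d\<bar> = 1"
  then have units: "c = 1 \<or> c = - 1" "d = 1 \<or> d = - 1" by auto
  have "uf_satisfies (string_uf [1] U) 3 (\<lambda>b. c * (b ! 0 - b ! 1) + d * b ! 2)"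
    if U: "U \<in> beta_Z" "idempotent_uf U" for U
    unfolding uf_satisfies_def
  proof (intro allI impI)
    fix A assume "\<forall>\<^sub>F n in string_uf [1] U. n \<in> A"
    then have "\<forall>\<^sub>F n in U. n \<in> A" by (simp add: uf_scale_def)
    with U obtain a b where ab: "a \<in> A" "b \<in> A" "a + b \<in> A"
      by (rule idempotent_uf_Schur_triple)
    show "\<exists>bs. length bs = 3 \<and> set bs \<subseteq> A \<and> c * (bs ! 0 - bs ! 1) + d * bs ! 2 = 0"
    proof (cases "c = d")
      case True
      then show ?thesis using ab by (intro exI[of _ "[a, a + b, b]"]) (auto simp: algebra_simps)
    next
      case False
      then have "d = - c" using units by auto
      then show ?thesis using ab by (intro exI[of _ "[a + b, a, b]"]) (auto simp: algebra_simps)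
    qed
  qed
  then show "\<exists>\<sigma> :: int list. \<sigma> \<noteq> [] \<and> reduced_string \<sigma> \<and>
            (\<forall>U\<in>beta_Z. idempotent_uf U \<longrightarrow>
               uf_satisfies (string_uf \<sigma> U) 3 (\<lambda>b. c * (b ! 0 - b ! 1) + d * b ! 2))"
    by (intro exI[of _ "[1]"]) (auto simp: reduced_string_def)
qed

end
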